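(* Let $k>2$ and $n\ge 4$ be integers. Then \[ \gamma_{[k]R}(C_9 \Box P_n) \le 9 (n-2)\left\lceil\frac{k+4}{5}\right\rceil + 18\left\lceil \frac{k+3-\left\lceil\frac{k+4}{5}\right\rceil}{3} \right\rceil \le \frac{9nk+81n+6k-6}{5}. \]
   Context: All graphs are finite and simple. For a vertex $v$ of a graph $G$, $N(v)$ denotes its open neighborhood and $N[v]=N(v)\cup\{v\}$ its closed neighborhood. For $f:V(G)\to\mathbb{N}_0$ and $S\subseteq V(G)$ write $f(S)=\sum_{u\in S}f(u)$. For a positive integer $k$, a $[k]$-Roman dominating function of $G$ is a function $f:V(G)\to\{0,1,\dots,k+1\}$ such that every vertex $v$ with $f(v)<k$ satisfies $f(N[v])\ge k+|AN(v)|$, where $AN(v)=\{u\in N(v): f(u)>0\}$. The $[k]$-Roman domination number $\gamma_{[k]R}(G)$ is the minimum of $f(V(G))$ over all $[k]$-Roman dominating functions $f$ of $G$. $C_m\Box P_n$ denotes the Cartesian product of the cycle $C_m$ ($m\ge3$) and the path $P_n$ on $n$ vertices: its vertices are pairs $(i,j)$ with $i\in\{0,\dots,m-1\}$, $j\in\{0,\dots,n-1\}$, and $(i,j)$ is adjacent to $(i',j')$ iff either $j=j'$ and $i-i'\equiv\pm1\pmod m$, or $i=i'$ and $|j-j'|=1$. *)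

theory Defs
  imports
    Complex_Main
    "HOL-Number_Theory.Cong"
    "Graph_Theory.Pair_Digraph"
begin

text \<open>
  Finite simple graphs are modelled as in \<open>Graph_Theory\<close>: each edge is represented by its two
  opposite arcs, and the locale \<open>pair_graph\<close> states that the arc set is finite, symmetric
  and loop-free.
\<close>

section \<open>Neighbourhoods and \<open>[k]\<close>-Roman domination\<close>

definition open_nbhd :: "'a pair_pre_digraph \<Rightarrow> 'a \<Rightarrow> 'a set" where
  "open_nbhd G v = {u. (v, u) \<in> parcs G}"

definition closed_nbhd :: "'a pair_pre_digraph \<Rightarrow> 'a \<Rightarrow> 'a set" where
  "closed_nbhd G v = open_nbhd G v \<union> {v}"

definition active_nbhd :: "'a pair_pre_digraph \<Rightarrow> ('a \<Rightarrow> nat) \<Rightarrow> 'a \<Rightarrow> 'a set" where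
  "active_nbhd G f v = {u \<in> open_nbhd G v. f u > 0}"

text \<open>
  Functions on the vertex set are total functions on the ambient type; only their values on
  \<open>pverts G\<close> matter.
\<close>

definition k_roman_dominating :: "nat \<Rightarrow> 'a pair_pre_digraph \<Rightarrow> ('a \<Rightarrow> nat) \<Rightarrow> bool" where
  "k_roman_dominating k G f \<longleftrightarrow>
     f ` pverts G \<subseteq> {0..k + 1} \<and>
     (\<forall>v \<in> pverts G. f v < k \<longrightarrow>
        (\<Sum>u \<in> closed_nbhd G v. f u) \<ge> k + card (active_nbhd G f v))"

definition k_roman_domination_number :: "nat \<Rightarrow> 'a pair_pre_digraph \<Rightarrow> nat" where
  "k_roman_domination_number k G =
     (LEAST w. \<exists>f. k_roman_dominating k G f \<and> w = (\<Sum>v \<in> pverts G. f v))"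

text \<open>The minimum is attained, since the constant function \<open>k\<close> is always admissible.\<close>

lemma k_roman_dominating_const: "k_roman_dominating k G (\<lambda>_. k)"
  by (auto simp: k_roman_dominating_def)

lemma k_roman_domination_number_attained:
  "\<exists>f. k_roman_dominating k G f \<and> k_roman_domination_number k G = (\<Sum>v \<in> pverts G. f v)"
  unfolding k_roman_domination_number_def
  by (rule LeastI_ex) (use k_roman_dominating_const in blast)

lemma k_roman_domination_number_le:
  assumes "k_roman_dominating k G f"
  shows "k_roman_domination_number k G \<le> (\<Sum>v \<in> pverts G. f v)"
  unfolding k_roman_domination_number_def
  by (rule Least_le) (use assms in blast)


section \<open>Cycles, paths and Cartesian products\<close>

text \<open>\<open>cycle_graph m\<close> is a cycle only for \<open>m \<ge> 3\<close>.\<close>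

definition cycle_graph :: "nat \<Rightarrow> nat pair_pre_digraph" where
  "cycle_graph m =
     \<lparr> pverts = {0..<m},
       parcs = {(i, i'). i \<in> {0..<m} \<and> i' \<in> {0..<m} \<and>
                  ([int i - int i' = 1] (mod int m) \<or> [int i - int i' = -1] (mod int m))} \<rparr>"

definition path_graph :: "nat \<Rightarrow> nat pair_pre_digraph" where
  "path_graph n =
     \<lparr> pverts = {0..<n},
       parcs = {(j, j'). j \<in> {0..<n} \<and> j' \<in> {0..<n} \<and> \<bar>int j - int j'\<bar> = 1} \<rparr>"

definition cartesian_product ::
    "'a pair_pre_digraph \<Rightarrow> 'b pair_pre_digraph \<Rightarrow> ('a \<times> 'b) pair_pre_digraph"
    (infixl "\<box>" 70) where
  "G \<box> H =
     \<lparr> pverts = pverts G \<times> pverts H,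
       parcs = {((x, y), (x', y')).
                  ((x, x') \<in> parcs G \<and> y = y' \<and> y \<in> pverts H) \<or>
                  (x = x' \<and> x \<in> pverts G \<and> (y, y') \<in> parcs H)} \<rparr>"

lemma pair_graph_cycle_graph:
  assumes "m \<ge> 3"
  shows "pair_graph (cycle_graph m)"
proof
  show "finite (parcs (cycle_graph m))"
    by (rule finite_subset[of _ "{0..<m} \<times> {0..<m}"]) (auto simp: cycle_graph_def)
  have "[int j - int i = - c] (mod int m)"
    if "[int i - int j = c] (mod int m)" for i j c
    using that by (metis cong_minus_minus_iff minus_diff_eq)
  from this[of _ _ 1] this[of _ _ "-1"] show "symmetric (cycle_graph m)"
    by (auto simp: symmetric_def sym_def cycle_graph_def)
  show "fst e \<noteq> snd e" if "e \<in> parcs (cycle_graph m)" for e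
    using that assms
    by (auto simp: cycle_graph_def cong_iff_dvd_diff)
qed (auto simp: cycle_graph_def)

lemma pair_graph_path_graph: "pair_graph (path_graph n)"
proof
  show "finite (parcs (path_graph n))"
    by (rule finite_subset[of _ "{0..<n} \<times> {0..<n}"]) (auto simp: path_graph_def)
qed (auto simp: path_graph_def symmetric_def sym_def)

lemma pair_graph_cartesian_product:
  assumes "pair_graph G" "pair_graph H"
  shows "pair_graph (G \<box> H)"
proof -
  interpret G: pair_graph G by fact
  interpret H: pair_graph H by fact
  show ?thesis
  proof
    show "finite (parcs (G \<box> H))"
      by (rule finite_subset[of _ "(pverts G \<times> pverts H) \<times> (pverts G \<times> pverts H)"])
         (auto simp: cartesian_product_def dest: G.wellformed' H.wellformed')
    show "symmetric (G \<box> H)"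
      using G.pair_sym_arcs H.pair_sym_arcs
      by (auto simp: symmetric_def sym_def cartesian_product_def)
  qed (auto simp: cartesian_product_def dest: G.wellformed' H.wellformed'
        G.pair_no_loops H.pair_no_loops)
qed

lemma parcs_cycle_box_path:
  "((i, j), (i', j')) \<in> parcs (cycle_graph m \<box> path_graph n) \<longleftrightarrow>
     i < m \<and> i' < m \<and> j < n \<and> j' < n \<and>
     (j = j' \<and> ([int i - int i' = 1] (mod int m) \<or> [int i - int i' = -1] (mod int m)) \<or>
      i = i' \<and> \<bar>int j - int j'\<bar> = 1)"
  by (auto simp: cartesian_product_def cycle_graph_def path_graph_def)

end

theory Submission
  imports Defs
begin

text \<open>
  Give every vertex of the two boundary cycles the weight \<open>b = \<lceil>(k + 3 - a) / 3\<rceil>\<close> and every other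
  vertex the weight \<open>a = \<lceil>(k + 4) / 5\<rceil>\<close>. All neighbours are then active, so interior vertices away
  from the boundary need \<open>5 a \<ge> k + 4\<close> and boundary vertices need \<open>3 b + a \<ge> k + 3\<close>. Interior
  vertices next to the boundary are fine as soon as \<open>a \<le> b\<close>, which is what \<open>k > 2\<close> ensures.
\<close>

lemma open_nbhd_cartesian_product:
  assumes "x \<in> pverts G" "y \<in> pverts H"
  shows "open_nbhd (G \<box> H) (x, y) = open_nbhd G x \<times> {y} \<union> {x} \<times> open_nbhd H y"
  using assms by (auto simp: open_nbhd_def cartesian_product_def)

lemma open_nbhd_path_graph:
  assumes "j < n"
  shows "open_nbhd (path_graph n) j =
           (if j = 0 then {} else {j - 1}) \<union> (if j + 1 < n then {j + 1} else {})"
  using assms by (auto simp: open_nbhd_def path_graph_def abs_if split: if_splits)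

lemma open_nbhd_cycle_graph:
  assumes "m \<ge> 3" "i < m"
  shows "open_nbhd (cycle_graph m) i =
           {if i = 0 then m - 1 else i - 1, if i = m - 1 then 0 else i + 1}"
proof -
  \<comment> \<open>For \<open>i, u < m\<close> the differences \<open>i - u - 1\<close> and
    \<open>i - u + 1\<close> have absolute value at most \<open>m\<close>, so the congruence reduces
    to three linear cases: two give the ordinary neighbours, wrap-around the others.\<close>
  have dvd_iff: "int m dvd d \<longleftrightarrow> d = 0 \<or> d = int m \<or> d = - int m"
    if "\<bar>d\<bar> < 2 * int m" for d
  proof
    assume "int m dvd d"
    then obtain q where q: "d = int m * q" ..
    with that assms have "\<bar>q\<bar> < 2"
      by (simp add: abs_mult mult.commute)
    then have "q = 0 \<or> q = 1 \<or> q = - 1"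
      by linarith
    with q show "d = 0 \<or> d = int m \<or> d = - int m"
      by auto
  qed auto
  have "u \<in> open_nbhd (cycle_graph m) i \<longleftrightarrow>
          u \<in> {if i = 0 then m - 1 else i - 1, if i = m - 1 then 0 else i + 1}" for u
  proof (cases "u < m")
    case True
    have "u \<in> open_nbhd (cycle_graph m) i \<longleftrightarrow>
            int m dvd (int i - int u - 1) \<or> int m dvd (int i - int u + 1)"
      using True assms by (simp add: open_nbhd_def cycle_graph_def cong_iff_dvd_diff)
    also have "\<dots> \<longleftrightarrow> u \<in> {if i = 0 then m - 1 else i - 1, if i = m - 1 then 0 else i + 1}"
      using True assms by (subst (1 2) dvd_iff) (auto split: if_splits)
    finally show ?thesis .
  next
    case False
    then show ?thesis
      using assms by (auto simp: open_nbhd_def cycle_graph_def)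
  qed
  then show ?thesis
    by blast
qed

text \<open>\<open>m \<ge> 3\<close> keeps the predecessor and the successor of \<open>i\<close>
  distinct.\<close>

lemma card_open_nbhd_cycle_graph:
  assumes "m \<ge> 3" "i < m"
  shows "card (open_nbhd (cycle_graph m) i) = 2"
  using assms by (auto simp: open_nbhd_cycle_graph card_insert_if)

text \<open>A weight constant on the copies of \<open>G\<close> reduces domination to one inequality
  per vertex of \<open>H\<close>: a vertex and its \<open>r\<close> neighbours in its copy together
  carry \<open>(r + 1) * g y\<close>. Counting every neighbour as active is the worst case, since
  inactive ones only lower the demand.\<close>

lemma k_roman_dominating_product_snd:
  fixes g :: "'b \<Rightarrow> nat"
  assumes G: "pair_graph G" and H: "pair_graph H"
    and regular: "\<And>x. x \<in> pverts G \<Longrightarrow> card (open_nbhd G x) = r"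
    and range: "\<And>y. y \<in> pverts H \<Longrightarrow> g y \<le> k + 1"
    and dominated: "\<And>y. y \<in> pverts H \<Longrightarrow>
          (r + 1) * g y + (\<Sum>z \<in> open_nbhd H y. g z) \<ge> k + r + card (open_nbhd H y)"
  shows "k_roman_dominating k (G \<box> H) (\<lambda>v. g (snd v))"
  unfolding k_roman_dominating_def
proof (intro conjI ballI impI)
  show "(\<lambda>v. g (snd v)) ` pverts (G \<box> H) \<subseteq> {0..k + 1}"
    using range by (auto simp: cartesian_product_def)
next
  fix v assume "v \<in> pverts (G \<box> H)"
  then obtain x y where v: "v = (x, y)" "x \<in> pverts G" "y \<in> pverts H"
    by (auto simp: cartesian_product_def)
  interpret G: pair_graph G by fact
  interpret H: pair_graph H by fact
  let ?A = "open_nbhd G x \<times> {y}" and ?B = "{x} \<times> open_nbhd H y"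
  have fin: "finite (open_nbhd G x)" "finite (open_nbhd H y)"
    by (rule finite_subset[OF _ G.finite_verts], use G.wellformed' in \<open>auto simp: open_nbhd_def\<close>)
       (rule finite_subset[OF _ H.finite_verts], use H.wellformed' in \<open>auto simp: open_nbhd_def\<close>)
  \<comment> \<open>Looplessness makes \<open>?A\<close> and \<open>?B\<close> disjoint and keeps
    \<open>v\<close> out of both, so no weight is counted twice.\<close>
  have loop: "x \<notin> open_nbhd G x" "y \<notin> open_nbhd H y"
    by (auto simp: open_nbhd_def dest: G.pair_no_loops H.pair_no_loops)
  have nbhd: "open_nbhd (G \<box> H) v = ?A \<union> ?B" and disj: "?A \<inter> ?B = {}"
    using v loop by (auto simp: open_nbhd_cartesian_product)
  have "(\<Sum>u \<in> closed_nbhd (G \<box> H) v. g (snd u)) = g y + (\<Sum>u \<in> ?A \<union> ?B. g (snd u))"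
    unfolding closed_nbhd_def nbhd using fin loop v by simp
  also have "\<dots> = g y + ((\<Sum>u \<in> ?A. g (snd u)) + (\<Sum>u \<in> ?B. g (snd u)))"
    using fin disj by (subst sum.union_disjoint) auto
  also have "(\<Sum>u \<in> ?A. g (snd u)) = r * g y"
    by (simp add: sum.cartesian_product' regular[OF v(2)])
  also have "(\<Sum>u \<in> ?B. g (snd u)) = (\<Sum>z \<in> open_nbhd H y. g z)"
    by (simp add: sum.cartesian_product')
  finally have sum: "(\<Sum>u \<in> closed_nbhd (G \<box> H) v. g (snd u)) =
      (r + 1) * g y + (\<Sum>z \<in> open_nbhd H y. g z)"
    by simp
  have "card (active_nbhd (G \<box> H) (\<lambda>v. g (snd v)) v) \<le> card (?A \<union> ?B)"
    using fin by (intro card_mono) (auto simp: active_nbhd_def nbhd)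
  also have "\<dots> = r + card (open_nbhd H y)"
    using fin disj regular[OF v(2)] by (simp add: card_Un_disjoint card_cartesian_product)
  finally show "(\<Sum>u \<in> closed_nbhd (G \<box> H) v. g (snd u))
      \<ge> k + card (active_nbhd (G \<box> H) (\<lambda>v. g (snd v)) v)"
    using dominated[OF v(3)] sum by linarith
qed

text \<open>Only linear inequalities on \<open>a\<close> and \<open>b\<close> enter here, so all
  rounding is left to the final theorem. The cycle matters only through its order and its
  2-regularity.\<close>

lemma k_roman_domination_number_cycle_box_path_le:
  fixes a b k m n :: nat
  assumes m: "m \<ge> 3" and n: "n \<ge> 3"
    and ab: "a \<le> b" "b \<le> k + 1" and inner: "k + 4 \<le> 5 * a" and outer: "k + 3 \<le> a + 3 * b"
  shows "k_roman_domination_number k (cycle_graph m \<box> path_graph n) \<le> m * ((n - 2) * a + 2 * b)"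
proof -
  define g where "g j = (if j = 0 \<or> j = n - 1 then b else a)" for j
  have "k_roman_dominating k (cycle_graph m \<box> path_graph n) (\<lambda>v. g (snd v))"
  proof (rule k_roman_dominating_product_snd[where r = 2])
    show "card (open_nbhd (cycle_graph m) x) = 2" if "x \<in> pverts (cycle_graph m)" for x
      using that by (intro card_open_nbhd_cycle_graph m) (simp add: cycle_graph_def)
    show "g y \<le> k + 1" if "y \<in> pverts (path_graph n)" for y
      using ab by (simp add: g_def)
    show "(2 + 1) * g y + (\<Sum>z \<in> open_nbhd (path_graph n) y. g z)
            \<ge> k + 2 + card (open_nbhd (path_graph n) y)"
      if "y \<in> pverts (path_graph n)" for y
    proof -
      have y: "y < n"
        using that by (simp add: path_graph_def)
      \<comment> \<open>An end layer has a single path neighbour, which carries \<open>a\<close>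
        because \<open>n \<ge> 3\<close>; its demand is thus
        \<open>3 * b + a \<ge> k + 3\<close>.\<close>
      consider "y = 0" | "y = n - 1" | "0 < y" "y < n - 1"
        using y by linarith
      then show ?thesis
      proof cases
        case 1
        then show ?thesis
          using n outer by (auto simp: open_nbhd_path_graph g_def)
      next
        case 2
        then show ?thesis
          using n outer by (auto simp: open_nbhd_path_graph g_def)
      next
        case 3
        \<comment> \<open>Bounding all five weights below by \<open>a\<close> treats the layers next
          to an end together with the remaining interior ones.\<close>
        have "a \<le> g j" for j
          using ab by (simp add: g_def)
        from this[of y] this[of "y - 1"] this[of "y + 1"] show ?thesis
          using 3 inner by (auto simp: open_nbhd_path_graph)
      qed
    qed
  qed (use m in \<open>simp_all add: pair_graph_cycle_graph pair_graph_path_graph\<close>)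
  then have "k_roman_domination_number k (cycle_graph m \<box> path_graph n)
      \<le> (\<Sum>v \<in> pverts (cycle_graph m \<box> path_graph n). g (snd v))"
    by (rule k_roman_domination_number_le)
  also have "\<dots> = m * (\<Sum>j < n. g j)"
    by (simp add: cartesian_product_def cycle_graph_def path_graph_def sum.cartesian_product'
        atLeast0LessThan)
  also have "(\<Sum>j < n. g j) = (n - 2) * a + 2 * b"
  proof -
    \<comment> \<open>Both end layers are split off; the \<open>l = n - 2\<close> layers between
      them are the \<open>Suc j\<close> with \<open>j < l\<close>.\<close>
    obtain l where l: "n = Suc (Suc l)"
      using n by (metis add_2_eq_Suc le_Suc_ex numeral_3_eq_3 add_Suc)
    have "(\<Sum>j < n. g j) = g 0 + (\<Sum>j < l. g (Suc j)) + g (Suc l)"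
      by (simp only: l sum.lessThan_Suc[of _ "Suc l"] sum.lessThan_Suc_shift[of _ l] comp_def)
    also have "(\<Sum>j < l. g (Suc j)) = (\<Sum>j < l. a)"
      by (intro sum.cong) (auto simp: g_def l)
    finally show ?thesis
      by (simp add: g_def l)
  qed
  finally show ?thesis .
qed

text \<open>Turns ceilings of fractions into integer linear constraints. Integrality sharpens the
  strict bound \<open>q * (?c - 1) < p\<close> by one, which gives the \<open>- 1\<close> in the
  second claim.\<close>

lemma ceiling_divide_bounds:
  fixes p q :: int
  assumes "q > 0"
  shows "p \<le> q * \<lceil>real_of_int p / real_of_int q\<rceil>"
    and "q * \<lceil>real_of_int p / real_of_int q\<rceil> \<le> p + q - 1"
proof -
  let ?c = "\<lceil>real_of_int p / real_of_int q\<rceil>"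
  have "real_of_int p \<le> real_of_int (q * ?c)" "real_of_int (q * (?c - 1)) < real_of_int p"
    using assms ceiling_correct[of "real_of_int p / real_of_int q"]
      pos_divide_le_eq[of "real_of_int q" "real_of_int p" "real_of_int ?c"]
      pos_less_divide_eq[of "real_of_int q" "real_of_int ?c - 1" "real_of_int p"]
    by (simp_all add: mult.commute)
  then show "p \<le> q * ?c" "q * ?c \<le> p + q - 1"
    by (simp_all only: of_int_le_iff of_int_less_iff) (simp_all add: algebra_simps)
qed

theorem theorem2:
  fixes k n :: nat
  assumes "k > 2" and "n \<ge> 4"
  shows "real (k_roman_domination_number k (cycle_graph 9 \<box> path_graph n))
           \<le> 9 * (real n - 2) * real_of_int \<lceil>(real k + 4) / 5\<rceil>
             + 18 * real_of_int \<lceil>(real k + 3 - real_of_int \<lceil>(real k + 4) / 5\<rceil>) / 3\<rceil>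
       \<and> 9 * (real n - 2) * real_of_int \<lceil>(real k + 4) / 5\<rceil>
             + 18 * real_of_int \<lceil>(real k + 3 - real_of_int \<lceil>(real k + 4) / 5\<rceil>) / 3\<rceil>
           \<le> (9 * real n * real k + 81 * real n + 6 * real k - 6) / 5"
proof -
  define A B where "A = \<lceil>(real k + 4) / 5\<rceil>" and "B = \<lceil>(real k + 3 - real_of_int A) / 3\<rceil>"
  have A: "int k + 4 \<le> 5 * A" "5 * A \<le> int k + 8"
    using ceiling_divide_bounds[of 5 "int k + 4"] by (simp_all add: A_def)
  have B: "int k + 3 - A \<le> 3 * B" "3 * B \<le> int k + 5 - A"
    using ceiling_divide_bounds[of 3 "int k + 3 - A"] by (simp_all add: B_def)
  \<comment> \<open>If \<open>B \<le> A - 1\<close>, then \<open>4 * A \<ge> k + 6\<close>, which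
    with \<open>5 * A \<le> k + 8\<close> forces \<open>k \<le> 2\<close>. The bound is sharp:
    \<open>k = 2\<close> gives \<open>A = 2\<close> and \<open>B = 1\<close>.\<close>
  have "A \<ge> 0" "A \<le> B" "B \<le> int k + 1"
    using A B assms(1) by linarith+
  then obtain a b where ab: "A = int a" "B = int b"
    by (metis nonneg_int_cases order_trans)
  have "k_roman_domination_number k (cycle_graph 9 \<box> path_graph n) \<le> 9 * ((n - 2) * a + 2 * b)"
    by (rule k_roman_domination_number_cycle_box_path_le)
       (use assms A B \<open>A \<le> B\<close> \<open>B \<le> int k + 1\<close> ab in linarith)+
  then have "real (k_roman_domination_number k (cycle_graph 9 \<box> path_graph n))
      \<le> real (9 * ((n - 2) * a + 2 * b))"
    by (simp only: of_nat_le_iff)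
  also have "\<dots> = 9 * (real n - 2) * A + 18 * real_of_int B"
    using assms(2) by (simp add: ab of_nat_diff)
  finally have upper: "real (k_roman_domination_number k (cycle_graph 9 \<box> path_graph n))
      \<le> 9 * (real n - 2) * A + 18 * real_of_int B" .
  \<comment> \<open>\<open>B\<close> is eliminated before \<open>A\<close>, because its bound
    decreases in \<open>A\<close>: the coefficient of \<open>A\<close> drops to
    \<open>9 * n - 24\<close>, still nonnegative for \<open>n \<ge> 4\<close>, so that the upper
    bound on \<open>A\<close> can be inserted next.\<close>
  have "9 * (real n - 2) * A + 18 * real_of_int B \<le> 9 * (real n - 2) * A + 6 * (real k + 5 - A)"
  proof -
    have "real_of_int (3 * B) \<le> real_of_int (int k + 5 - A)"
      using B(2) by (simp only: of_int_le_iff)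
    then show ?thesis
      by simp
  qed
  also have "\<dots> = (9 * real n - 24) * A + 6 * real k + 30"
    by (simp add: algebra_simps)
  also have "\<dots> \<le> (9 * real n - 24) * ((real k + 8) / 5) + 6 * real k + 30"
  proof -
    have "real_of_int (5 * A) \<le> real_of_int (int k + 8)"
      using A(2) by (simp only: of_int_le_iff)
    then have "real_of_int A \<le> (real k + 8) / 5"
      by simp
    then show ?thesis
      using assms(2) by (intro add_right_mono mult_left_mono) auto
  qed
  \<comment> \<open>The right-hand side exceeds the left by exactly
    \<open>(9 * n + 36) / 5\<close>.\<close>
  also have "\<dots> \<le> (9 * real n * real k + 81 * real n + 6 * real k - 6) / 5"
    by (simp add: field_simps)
  finally show ?thesis
    using upper unfolding A_def B_def by blast
qed

end
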